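(* Let $X\in\mathbb{R}^{m\times s}$, $Y\in\mathbb{R}^{n\times s}$, let $k_1,k_2$ be positive integers with $k_1+k_2=k\le\min\{m,n\}$, let $V^{(0)}\in\mathbb{R}^{q\times s}$ be arbitrary, and put $G=I-Y^\dagger Y\in\mathbb{R}^{s\times s}$ and $Z^{(0)}=V^{(0)}G\in\mathbb{R}^{q\times s}$. Then the problem $$\min_{D_1\in\mathbb{R}^{m\times k_1},\,C_1\in\mathbb{R}^{k_1\times n}}\ \ \min_{D_2\in\mathbb{R}^{m\times k_2},\,C_2\in\mathbb{R}^{k_2\times q}}\ \bigl\|X-[D_1C_1Y+D_2C_2Z^{(0)}]\bigr\|^2$$ is solved by $$D_1=D_1^{(0)}=U_{T_Y,k_1},\qquad C_1=C_1^{(0)}=U_{T_Y,k_1}^T\,X\,Y^\dagger,$$ $$D_2=D_2^{(0)}=U_{T_{Z^{(0)}},k_2},\qquad C_2=C_2^{(0)}=U_{T_{Z^{(0)}},k_2}^T\,X\,(Z^{(0)})^\dagger .$$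
   Context: $\|\cdot\|$ is the Frobenius norm, $M^\dagger$ is the Moore–Penrose pseudo-inverse of $M$, and $I$ is the identity matrix. For a matrix $A\in\mathbb{R}^{m\times p}$ with singular value decomposition $A=U_A\Sigma_AV_A^T$ ($U_A=[u_1\ \dots\ u_m]$ and $V_A$ orthogonal, singular values in non-increasing order), $U_{A,j}=[u_1\ \dots\ u_j]$ denotes the matrix of the first $j$ columns of $U_A$. For a matrix $Y$ with $s$ columns, $S_Y=XY^T\bigl((YY^T)^{1/2}\bigr)^\dagger$ and $T_Y=S_YS_Y^T\in\mathbb{R}^{m\times m}$. Similarly, for $Z=Z^{(0)}$, $S_Z=XZ^T\bigl((ZZ^T)^{1/2}\bigr)^\dagger$ and $T_Z=S_ZS_Z^T$. *)

theory Defs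
  imports Complex_Main "Jordan_Normal_Form.Matrix"
begin

definition frob_norm :: "real mat \<Rightarrow> real" where
  "frob_norm A = sqrt (\<Sum>i<dim_row A. \<Sum>j<dim_col A. (A $$ (i,j))\<^sup>2)"

text \<open>The four Penrose equations. They have exactly one solution for every real matrix.\<close>

definition is_pinv :: "real mat \<Rightarrow> real mat \<Rightarrow> bool" where
  "is_pinv A B \<longleftrightarrow>
     B \<in> carrier_mat (dim_col A) (dim_row A) \<and>
     A * B * A = A \<and> B * A * B = B \<and>
     transpose_mat (A * B) = A * B \<and> transpose_mat (B * A) = B * A"

definition pinv :: "real mat \<Rightarrow> real mat" where
  "pinv A = (THE B. is_pinv A B)"

definition psd_mat :: "real mat \<Rightarrow> bool" where
  "psd_mat A \<longleftrightarrow>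
     square_mat A \<and> transpose_mat A = A \<and>
     (\<forall>v \<in> carrier_vec (dim_row A). 0 \<le> v \<bullet> (A *\<^sub>v v))"

text \<open>The positive semidefinite square root; meaningful for positive semidefinite arguments,
  where it exists and is unique.\<close>

definition sqrt_mat :: "real mat \<Rightarrow> real mat" where
  "sqrt_mat A = (THE B. B \<in> carrier_mat (dim_row A) (dim_row A) \<and> psd_mat B \<and> B * B = A)"

text \<open>The library's \<^const>\<open>orthogonal_mat\<close> only asks for pairwise orthogonal nonzero columns,
  which need not be normalised.\<close>

definition orthonormal_mat :: "real mat \<Rightarrow> bool" where
  "orthonormal_mat U \<longleftrightarrow>
     square_mat U \<and>
     transpose_mat U * U = 1\<^sub>m (dim_row U) \<and> U * transpose_mat U = 1\<^sub>m (dim_row U)"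

definition is_svd :: "real mat \<Rightarrow> real mat \<Rightarrow> real mat \<Rightarrow> real mat \<Rightarrow> bool" where
  "is_svd A U \<Sigma> V \<longleftrightarrow>
     U \<in> carrier_mat (dim_row A) (dim_row A) \<and> orthonormal_mat U \<and>
     V \<in> carrier_mat (dim_col A) (dim_col A) \<and> orthonormal_mat V \<and>
     \<Sigma> \<in> carrier_mat (dim_row A) (dim_col A) \<and> diagonal_mat \<Sigma> \<and>
     (\<forall>i < min (dim_row A) (dim_col A). 0 \<le> \<Sigma> $$ (i,i)) \<and>
     (\<forall>i j. i \<le> j \<longrightarrow> j < min (dim_row A) (dim_col A) \<longrightarrow> \<Sigma> $$ (j,j) \<le> \<Sigma> $$ (i,i)) \<and>
     A = U * \<Sigma> * transpose_mat V"

text \<open>Meaningful for \<open>j \<le> dim_col U\<close>.\<close>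

definition first_cols :: "real mat \<Rightarrow> nat \<Rightarrow> real mat" where
  "first_cols U j = mat (dim_row U) j (\<lambda>(i,l). U $$ (i,l))"

definition S_mat :: "real mat \<Rightarrow> real mat \<Rightarrow> real mat" where
  "S_mat X Y = X * transpose_mat Y * pinv (sqrt_mat (Y * transpose_mat Y))"

definition T_mat :: "real mat \<Rightarrow> real mat \<Rightarrow> real mat" where
  "T_mat X Y = S_mat X Y * transpose_mat (S_mat X Y)"

text \<open>An iterated minimum of a nonnegative objective is solved by a pair of arguments iff that
  pair solves the joint minimisation problem.\<close>

lemma is_arg_min_iterated:
  fixes f :: "'a \<Rightarrow> 'b \<Rightarrow> real"
  assumes nonneg: "\<And>x y. 0 \<le> f x y"
  shows "is_arg_min (\<lambda>(x,y). f x y) (\<lambda>(x,y). P x \<and> Q y) (x,y) \<longleftrightarrow>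
         is_arg_min (f x) Q y \<and> is_arg_min (\<lambda>x. INF y\<in>Collect Q. f x y) P x"
proof
  assume "is_arg_min (\<lambda>(x,y). f x y) (\<lambda>(x,y). P x \<and> Q y) (x,y)"
  then have P: "P x" and Q: "Q y" and le: "\<And>x' y'. P x' \<Longrightarrow> Q y' \<Longrightarrow> f x y \<le> f x' y'"
    by (fastforce simp: is_arg_min_def not_less)+
  have bdd: "bdd_below (f x ` Collect Q)" using nonneg by (meson bdd_belowI2)
  have up: "(INF y\<in>Collect Q. f x y) \<le> f x y" using Q bdd by (intro cINF_lower) auto
  have lo: "f x y \<le> (INF y\<in>Collect Q. f x' y)" if "P x'" for x'
    using Q le that by (intro cINF_greatest) auto
  have "(INF y\<in>Collect Q. f x y) \<le> (INF y\<in>Collect Q. f x' y)" if "P x'" for x'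
    using up lo[OF that] by (rule order_trans)
  then show "is_arg_min (f x) Q y \<and> is_arg_min (\<lambda>x. INF y\<in>Collect Q. f x y) P x"
    using P Q le unfolding is_arg_min_def by (meson not_less)
next
  assume *: "is_arg_min (f x) Q y \<and> is_arg_min (\<lambda>x. INF y\<in>Collect Q. f x y) P x"
  then have P: "P x" and Q: "Q y" and le: "\<And>y'. Q y' \<Longrightarrow> f x y \<le> f x y'"
    and le': "\<And>x'. P x' \<Longrightarrow> (INF y\<in>Collect Q. f x y) \<le> (INF y\<in>Collect Q. f x' y)"
    by (fastforce simp: is_arg_min_def not_less)+
  have "f x y \<le> f x' y'" if "P x'" "Q y'" for x' y'
  proof -
    have bdd: "bdd_below (f x' ` Collect Q)" using nonneg by (meson bdd_belowI2)
    have "f x y \<le> (INF y\<in>Collect Q. f x y)" using Q le by (intro cINF_greatest) auto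
    also have "\<dots> \<le> (INF y\<in>Collect Q. f x' y)" using le' that by blast
    also have "\<dots> \<le> f x' y'" using that bdd by (intro cINF_lower) auto
    finally show ?thesis .
  qed
  then show "is_arg_min (\<lambda>(x,y). f x y) (\<lambda>(x,y). P x \<and> Q y) (x,y)"
    using P Q by (auto simp: is_arg_min_def not_less)
qed

end

theory Submission
  imports Defs "Jordan_Normal_Form.Spectral_Radius"
begin

text \<open>
  Let \<open>P = Y\<^sup>\<dagger> Y\<close> and \<open>Q = Z\<^sup>\<dagger> Z\<close> be the orthogonal projections onto the row spaces of \<open>Y\<close> and of
  \<open>Z = V G\<close>. Because \<open>G = 1 - P\<close>, these row spaces are orthogonal, and the residual splits into
  three pieces that are orthogonal to each other:
  \<open>X - (D\<^sub>1 C\<^sub>1 Y + D\<^sub>2 C\<^sub>2 Z) = (X P - D\<^sub>1 C\<^sub>1 Y) + (X Q - D\<^sub>2 C\<^sub>2 Z) + X (1 - P) (1 - Q)\<close>.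
  The last piece is constant, and the first two share no unknown
  (\<open>frob_norm_orthogonal_split\<close>). So the joint problem consists of two independent problems of
  approximating \<open>X P\<close> and \<open>X Q\<close> by matrices of rank at most \<open>k\<^sub>1\<close> and \<open>k\<^sub>2\<close>.

  By the Eckart--Young theorem (\<open>eckart_young\<close>) a best approximation of \<open>M = X P\<close> of rank \<open>k\<close> is
  \<open>U\<^sub>k U\<^sub>k\<^sup>T M\<close>, where the columns of \<open>U\<^sub>k\<close> are eigenvectors for the \<open>k\<close> largest eigenvalues of
  \<open>M M\<^sup>T\<close>. It is of the required form, as \<open>U\<^sub>k U\<^sub>k\<^sup>T X P = U\<^sub>k (U\<^sub>k\<^sup>T X Y\<^sup>\<dagger>) Y\<close>.

  It remains to see that \<open>U\<^sub>k\<close> comes from a singular value decomposition of \<open>T\<^sub>Y\<close>. The matrix \<open>T\<^sub>Y\<close>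
  equals \<open>X P X\<^sup>T = M M\<^sup>T\<close> (\<open>T_mat_eq_proj\<close>), and for a positive semidefinite matrix the left singular
  vectors diagonalise it (\<open>psd_mat_svd\<close>). Both facts need existence and uniqueness of positive
  semidefinite square roots and of pseudo-inverses, since these are defined by description. They
  rest on the spectral theorem for real symmetric matrices (\<open>real_spectral_theorem\<close>).
\<close>

section \<open>Matrix algebra with explicit dimensions\<close>

text \<open>The library's ring laws for matrices name the common dimensions in carrier premises, which the
  simplifier would have to guess. Stated with equations between dimensions, the laws below can be
  used as ordinary conditional rewrite rules.\<close>

lemma mat_assoc:
  "dim_col A = dim_row B \<Longrightarrow> dim_col B = dim_row C \<Longrightarrow> (A * B) * C = A * (B * (C :: 'a :: semiring_0 mat))"
  by (rule assoc_mult_mat) auto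

lemma mat_transpose_mult:
  "dim_col A = dim_row B \<Longrightarrow> transpose_mat (A * B) = transpose_mat B * transpose_mat (A :: 'a :: comm_semiring_0 mat)"
  by (rule transpose_mult) auto

lemma mat_diff_mult:
  "dim_row A = dim_row B \<Longrightarrow> dim_col A = dim_col B \<Longrightarrow> dim_col B = dim_row C \<Longrightarrow>
   (A - B) * C = A * C - B * (C :: 'a :: ring mat)"
  by (rule minus_mult_distrib_mat) auto

lemma mat_mult_diff:
  "dim_row B = dim_row C \<Longrightarrow> dim_col B = dim_col C \<Longrightarrow> dim_col A = dim_row B \<Longrightarrow>
   A * (B - C) = A * B - A * (C :: 'a :: ring mat)"
  by (rule mult_minus_distrib_mat) auto

lemma mat_transpose_diff:
  "dim_row A = dim_row B \<Longrightarrow> dim_col A = dim_col B \<Longrightarrow>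
   transpose_mat (A - B) = transpose_mat A - transpose_mat (B :: 'a :: ab_group_add mat)"
  by (rule eq_matI) auto

lemma mat_one_mult: "dim_row A = n \<Longrightarrow> 1\<^sub>m n * A = (A :: 'a :: semiring_1 mat)"
  by (rule left_mult_one_mat) auto

lemma mat_mult_one: "dim_col A = n \<Longrightarrow> A * 1\<^sub>m n = (A :: 'a :: semiring_1 mat)"
  by (rule right_mult_one_mat) auto

lemmas mat_ring = mat_assoc mat_transpose_mult mat_diff_mult mat_mult_diff mat_transpose_diff
  mat_one_mult mat_mult_one

lemma mat_prod_index:
  "i < dim_row A \<Longrightarrow> j < dim_col B \<Longrightarrow> dim_col A = dim_row B \<Longrightarrow>
   (A * B) $$ (i,j) = (\<Sum>l<dim_row B. A $$ (i,l) * B $$ (l,j))"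
  by (simp add: scalar_prod_def lessThan_atLeast0)

section \<open>The spectral theorem for real symmetric matrices\<close>

text \<open>The characteristic polynomial has a complex root \<open>k\<close>, with eigenvector \<open>x + i y\<close>. By symmetry
  \<open>y \<bullet> A x = A y \<bullet> x\<close>, and expanding both sides leaves \<open>Im k * (x \<bullet> x + y \<bullet> y) = 0\<close>. So \<open>k\<close> is
  real, and whichever of \<open>x\<close>, \<open>y\<close> is nonzero is a real eigenvector.\<close>

lemma symmetric_mat_has_unit_eigenvector:
  fixes A :: "real mat"
  assumes A: "A \<in> carrier_mat n n" and sym: "transpose_mat A = A" and n: "0 < n"
  shows "\<exists>v c. v \<in> carrier_vec n \<and> v \<bullet> v = 1 \<and> A *\<^sub>v v = c \<cdot>\<^sub>v v"
proof -
  let ?C = "map_mat complex_of_real A"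
  have "?C \<in> carrier_mat n n" using A by simp
  then obtain k z where z: "z \<in> carrier_vec n" "z \<noteq> 0\<^sub>v n" and kz: "?C *\<^sub>v z = k \<cdot>\<^sub>v z"
    using spectrum_non_empty[of ?C n] n
    unfolding spectrum_def eigenvalue_def eigenvector_def by auto
  define x where "x = map_vec Re z"
  define y where "y = map_vec Im z"
  have x: "x \<in> carrier_vec n" and y: "y \<in> carrier_vec n" using z by (auto simp: x_def y_def)
  have row: "(\<Sum>j<n. complex_of_real (A $$ (i,j)) * z $ j) = k * z $ i" if "i < n" for i
    using arg_cong[OF kz, of "\<lambda>u. u $ i"] that A z
    by (simp add: scalar_prod_def lessThan_atLeast0)
  have Ax: "A *\<^sub>v x = Re k \<cdot>\<^sub>v x - Im k \<cdot>\<^sub>v y"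
    by (rule eq_vecI)
      (use A z arg_cong[OF row, of _ Re] in
        \<open>auto simp: x_def y_def scalar_prod_def lessThan_atLeast0\<close>)
  have Ay: "A *\<^sub>v y = Im k \<cdot>\<^sub>v x + Re k \<cdot>\<^sub>v y"
    by (rule eq_vecI)
      (use A z arg_cong[OF row, of _ Im] in
        \<open>auto simp: x_def y_def scalar_prod_def lessThan_atLeast0\<close>)
  have pos: "u \<bullet> u \<ge> 0" "u \<bullet> u = 0 \<longleftrightarrow> u = 0\<^sub>v n" if "u \<in> carrier_vec n" for u :: "real vec"
    using that by (auto simp: scalar_prod_def sum_nonneg sum_nonneg_eq_0_iff)
  have nz: "x \<noteq> 0\<^sub>v n \<or> y \<noteq> 0\<^sub>v n"
  proof (rule ccontr)
    assume "\<not> ?thesis"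
    then have "x $ i = 0" "y $ i = 0" if "i < n" for i using that by auto
    then have "z = 0\<^sub>v n"
      using z by (intro eq_vecI) (auto simp: x_def y_def complex_eq_iff)
    then show False using z by simp
  qed
  have "y \<bullet> (A *\<^sub>v x) = (A *\<^sub>v y) \<bullet> x"
    using transpose_vec_mult_scalar[OF A x y] sym by simp
  moreover have "y \<bullet> (A *\<^sub>v x) = Re k * (y \<bullet> x) - Im k * (y \<bullet> y)"
    unfolding Ax using x y by (simp add: scalar_prod_minus_distrib)
  moreover have "(A *\<^sub>v y) \<bullet> x = Im k * (x \<bullet> x) + Re k * (y \<bullet> x)"
    unfolding Ay using x y by (simp add: add_scalar_prod_distrib)
  ultimately have "Im k * (x \<bullet> x + y \<bullet> y) = 0" by (simp add: algebra_simps)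
  moreover have "x \<bullet> x + y \<bullet> y > 0"
    using nz pos[OF x] pos[OF y] by (metis add_nonneg_eq_0_iff add_nonneg_nonneg less_eq_real_def)
  ultimately have k0: "Im k = 0" by simp
  obtain u where u: "u \<in> carrier_vec n" "u \<noteq> 0\<^sub>v n" and Au: "A *\<^sub>v u = Re k \<cdot>\<^sub>v u"
  proof (cases "x = 0\<^sub>v n")
    case True
    have "A *\<^sub>v y = Re k \<cdot>\<^sub>v y"
      unfolding Ay using x y k0 by (intro eq_vecI) auto
    then show ?thesis using that[of y] True nz y by auto
  next
    case False
    have "A *\<^sub>v x = Re k \<cdot>\<^sub>v x"
      unfolding Ax using x y k0 by (intro eq_vecI) auto
    then show ?thesis using that[of x] False x by auto
  qed
  let ?r = "1 / sqrt (u \<bullet> u)"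
  have "u \<bullet> u > 0" using u pos[of u] by (simp add: less_eq_real_def)
  then have "(?r \<cdot>\<^sub>v u) \<bullet> (?r \<cdot>\<^sub>v u) = 1" using u by simp
  moreover have "A *\<^sub>v (?r \<cdot>\<^sub>v u) = Re k \<cdot>\<^sub>v (?r \<cdot>\<^sub>v u)"
    using A u Au by (simp add: mult_mat_vec smult_smult_assoc mult.commute)
  ultimately show ?thesis using u by (intro exI[of _ "?r \<cdot>\<^sub>v u"] exI[of _ "Re k"]) auto
qed

text \<open>The Householder reflection that exchanges \<open>v\<close> and the first unit vector. It serves to rotate an
  eigenvector into the first coordinate; being a symmetric involution, it is its own inverse.\<close>

lemma orthonormal_mat_with_first_column:
  fixes v :: "real vec"
  assumes v: "v \<in> carrier_vec n" and unit: "v \<bullet> v = 1" and n: "0 < n"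
  shows "\<exists>H. H \<in> carrier_mat n n \<and> transpose_mat H = H \<and> H * H = 1\<^sub>m n \<and> col H 0 = v"
proof (cases "v = unit_vec n 0")
  case True
  then show ?thesis using n by (intro exI[of _ "1\<^sub>m n"]) auto
next
  case False
  \<comment> \<open>The reflection is \<open>1 - 2 w w\<^sup>T / (w \<bullet> w)\<close> with \<open>w = v - e\<^sub>0\<close>; since \<open>v\<close> is a unit vector,
    \<open>w \<bullet> w = 2 (1 - v\<^sub>0)\<close>.\<close>
  define w where "w i = v $ i - (if i = 0 then 1 else 0)" for i
  define c where "c = 1 - v $ 0"
  have vv: "(\<Sum>i<n. v $ i * v $ i) = 1"
    using unit v by (simp add: scalar_prod_def lessThan_atLeast0)
  have "(\<Sum>i<n. w i * w i) =
      (\<Sum>i<n. v $ i * v $ i) + (\<Sum>i<n. if i = 0 then 1 - 2 * v $ 0 else 0)"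
    unfolding sum.distrib[symmetric] by (rule sum.cong) (auto simp: w_def algebra_simps)
  then have ww: "(\<Sum>i<n. w i * w i) = 2 * c"
    using vv n by (simp add: c_def)
  have c: "c \<noteq> 0"
  proof
    assume "c = 0"
    then have "\<forall>i\<in>{..<n}. w i * w i = 0"
      using ww by (subst sum_nonneg_eq_0_iff[symmetric]) auto
    then have "v = unit_vec n 0" using v by (intro eq_vecI) (auto simp: w_def)
    then show False using False by simp
  qed
  define H where "H = mat n n (\<lambda>(i,j). (if i = j then 1 else 0) - w i * w j / c)"
  have H: "H \<in> carrier_mat n n" by (simp add: H_def)
  have "H * H = 1\<^sub>m n"
  proof (rule eq_matI)
    fix i j assume "i < dim_row (1\<^sub>m n :: real mat)" "j < dim_col (1\<^sub>m n :: real mat)"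
    then have ij: "i < n" "j < n" by auto
    have "(H * H) $$ (i,j) = (\<Sum>l<n. ((if i = l then 1 else 0) - w i * w l / c) *
        ((if l = j then 1 else 0) - w l * w j / c))"
      using ij by (subst mat_prod_index) (auto simp: H_def)
    also have "\<dots> = (\<Sum>l<n. (if l = i then (if i = j then 1 else 0) - w i * w j / c else 0)
        - (if l = j then w i * w j / c else 0) + w i * w j / c / c * (w l * w l))"
      by (rule sum.cong) (auto simp: algebra_simps)
    also have "\<dots> = (if i = j then 1 else 0) - w i * w j / c - w i * w j / c + w i * w j / c / c * (2 * c)"
      unfolding sum.distrib sum_subtractf sum_distrib_left[symmetric] ww using ij by simp
    also have "\<dots> = 1\<^sub>m n $$ (i,j)" using c ij by simp
    finally show "(H * H) $$ (i,j) = 1\<^sub>m n $$ (i,j)" .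
  qed (auto simp: H_def)
  moreover have "transpose_mat H = H" by (rule eq_matI) (auto simp: H_def)
  moreover have "col H 0 = v"
    by (rule eq_vecI) (use n v c in \<open>auto simp: H_def w_def c_def field_simps\<close>)
  ultimately show ?thesis using H by blast
qed

lemma orthonormal_matD:
  assumes "orthonormal_mat U" "U \<in> carrier_mat n n"
  shows "transpose_mat U * U = 1\<^sub>m n" "U * transpose_mat U = 1\<^sub>m n"
  using assms by (auto simp: orthonormal_mat_def)

text \<open>The functional calculus in the orthonormal basis formed by the columns of \<open>U\<close>: square roots,
  pseudo-inverses and the projections onto leading eigenvectors of one symmetric matrix all arise
  from the same \<open>U\<close> by changing the eigenvalue function \<open>f\<close>.\<close>

definition spec_mat :: "real mat \<Rightarrow> (nat \<Rightarrow> real) \<Rightarrow> real mat" where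
  "spec_mat U f = U * mat_diag (dim_row U) f * transpose_mat U"

text \<open>By induction on the dimension: after a reflection that takes a unit eigenvector to the first
  coordinate, symmetry forces the first row and column to vanish off the diagonal, and the remaining
  block is again symmetric.\<close>

theorem real_spectral_theorem:
  assumes "A \<in> carrier_mat n n" and "transpose_mat A = A"
  shows "\<exists>U f. U \<in> carrier_mat n n \<and> orthonormal_mat U \<and> A = spec_mat U f"
  using assms
proof (induction n arbitrary: A)
  case 0
  then show ?case
    by (intro exI[of _ "1\<^sub>m 0"] exI[of _ "\<lambda>_. 0"]) (auto simp: orthonormal_mat_def spec_mat_def)
next
  case (Suc n)
  note A = Suc.prems(1) and sym = Suc.prems(2)
  obtain v c where v: "v \<in> carrier_vec (Suc n)" "v \<bullet> v = 1" and Av: "A *\<^sub>v v = c \<cdot>\<^sub>v v"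
    using symmetric_mat_has_unit_eigenvector[OF A sym] by auto
  obtain H where H: "H \<in> carrier_mat (Suc n) (Suc n)" and Hs: "transpose_mat H = H"
    and HH: "H * H = 1\<^sub>m (Suc n)" and Hv: "col H 0 = v"
    using orthonormal_mat_with_first_column[OF v] by auto
  note dH = carrier_matD[OF H] and dA = carrier_matD[OF A]
  define B where "B = H * A * H"
  have B: "B \<in> carrier_mat (Suc n) (Suc n)" using H A by (simp add: B_def)
  have Bs: "transpose_mat B = B" using dH dA by (simp add: B_def mat_ring Hs sym)
  have "col B 0 = H *\<^sub>v (A *\<^sub>v v)"
    using H A
    by (simp add: B_def col_mult2[of _ "Suc n" "Suc n" _ "Suc n"] Hv del: col_mult)
  also have "\<dots> = c \<cdot>\<^sub>v (H *\<^sub>v col H 0)"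
    using H v by (simp add: Av mult_mat_vec[of _ _ "Suc n"] Hv)
  also have "H *\<^sub>v col H 0 = col (H * H) 0"
    using H by (simp add: col_mult2[of _ "Suc n" "Suc n" _ "Suc n"] del: col_mult)
  finally have B0: "col B 0 = c \<cdot>\<^sub>v unit_vec (Suc n) 0" by (simp add: HH)
  have Bi0: "B $$ (i,0) = (if i = 0 then c else 0)" if "i < Suc n" for i
    using arg_cong[OF B0, of "\<lambda>u. u $ i"] that B by (auto simp: unit_vec_def)
  have B0i: "B $$ (0,i) = (if i = 0 then c else 0)" if "i < Suc n" for i
    using Bi0[OF that] arg_cong[OF Bs, of "\<lambda>M. M $$ (0,i)"] that B by simp
  define A' where "A' = mat n n (\<lambda>(i,j). B $$ (Suc i, Suc j))"
  have BA': "B = four_block_mat (mat 1 1 (\<lambda>_. c)) (0\<^sub>m 1 n) (0\<^sub>m n 1) A'"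
    by (rule eq_matI) (use B in \<open>auto simp: A'_def Bi0 B0i\<close>)
  have "transpose_mat A' = A'"
  proof (rule eq_matI)
    fix i j assume "i < dim_row A'" "j < dim_col A'"
    then show "transpose_mat A' $$ (i,j) = A' $$ (i,j)"
      using arg_cong[OF Bs, of "\<lambda>M. M $$ (Suc i, Suc j)"] B by (simp add: A'_def)
  qed (auto simp: A'_def)
  then obtain U' f' where U': "U' \<in> carrier_mat n n" and oU': "orthonormal_mat U'"
    and A'U': "A' = spec_mat U' f'"
    using Suc.IH[of A'] by (auto simp: A'_def)
  note dU' = carrier_matD[OF U'] and oU'' = orthonormal_matD[OF oU' U']
  define W where "W = four_block_mat (1\<^sub>m 1) (0\<^sub>m 1 n) (0\<^sub>m n 1) U'"
  define f where "f i = (case i of 0 \<Rightarrow> c | Suc j \<Rightarrow> f' j)" for i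
  have W: "W \<in> carrier_mat (Suc n) (Suc n)" using U' by (intro carrier_matI) (simp_all add: W_def)
  note dW = carrier_matD[OF W]
  have Wt: "transpose_mat W = four_block_mat (1\<^sub>m 1) (0\<^sub>m 1 n) (0\<^sub>m n 1) (transpose_mat U')"
    unfolding W_def using U' by (subst transpose_four_block_mat) auto
  have D: "mat_diag (Suc n) f = four_block_mat (mat 1 1 (\<lambda>_. c)) (0\<^sub>m 1 n) (0\<^sub>m n 1) (mat_diag n f')"
    by (rule eq_matI) (auto simp: mat_diag_def f_def split: nat.split)
  have one: "four_block_mat (1\<^sub>m 1) (0\<^sub>m 1 n) (0\<^sub>m n 1) (1\<^sub>m n) = (1\<^sub>m (Suc n) :: real mat)"
    by (rule eq_matI) auto
  have oW: "transpose_mat W * W = 1\<^sub>m (Suc n)" "W * transpose_mat W = 1\<^sub>m (Suc n)"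
    unfolding Wt unfolding W_def
    by (subst mult_four_block_mat, use U' oU'' one in \<open>auto\<close>)+
  \<comment> \<open>Two block multiplications; the eight premises of each are the dimensions of the blocks.\<close>
  have WBW: "W * mat_diag (Suc n) f * transpose_mat W = B"
    unfolding Wt D BA' A'U' spec_mat_def unfolding W_def
    apply (subst mult_four_block_mat) using U' apply (auto simp: mat_diag_def)[8]
    apply (subst mult_four_block_mat) using U' apply (auto simp: mat_diag_def)[8]
    using U' by (auto intro!: arg_cong2[where f = "\<lambda>a d. four_block_mat a _ _ d"] simp: mat_diag_def)
  define U where "U = H * W"
  have U: "U \<in> carrier_mat (Suc n) (Suc n)" using H W by (simp add: U_def)
  have "transpose_mat U * U = transpose_mat W * ((H * H) * W)"
    using dH dW by (simp add: U_def mat_ring Hs)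
  then have "transpose_mat U * U = 1\<^sub>m (Suc n)" using dW oW by (simp add: HH mat_ring)
  moreover have "U * transpose_mat U = H * ((W * transpose_mat W) * H)"
    using dH dW by (simp add: U_def mat_ring Hs)
  then have "U * transpose_mat U = 1\<^sub>m (Suc n)" using dH by (simp add: oW HH mat_ring)
  ultimately have oU: "orthonormal_mat U" using U by (simp add: orthonormal_mat_def)
  have "spec_mat U f = H * (W * mat_diag (Suc n) f * transpose_mat W) * H"
    using dH dW by (simp add: U_def spec_mat_def mat_ring Hs mat_diag_def)
  also have "\<dots> = (H * H) * A * (H * H)" unfolding WBW B_def using dH dA by (simp add: mat_ring)
  also have "\<dots> = A" using dA by (simp add: HH mat_ring)
  finally show ?case using U oU by metis
qed

section \<open>Trace and Frobenius norm\<close>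

definition trace_mat :: "'a :: comm_monoid_add mat \<Rightarrow> 'a" where
  "trace_mat A = (\<Sum>i<dim_row A. A $$ (i,i))"

lemma trace_mat_comm:
  fixes A B :: "'a :: comm_semiring_0 mat"
  assumes "dim_row A = dim_col B" and "dim_col A = dim_row B"
  shows "trace_mat (A * B) = trace_mat (B * A)"
proof -
  have "trace_mat (A * B) = (\<Sum>i<dim_row A. \<Sum>l<dim_row B. A $$ (i,l) * B $$ (l,i))"
    unfolding trace_mat_def using assms by (simp add: mat_prod_index del: index_mult_mat(1))
  also have "\<dots> = (\<Sum>l<dim_row B. \<Sum>i<dim_row A. B $$ (l,i) * A $$ (i,l))"
    by (subst sum.swap) (simp add: mult.commute)
  also have "\<dots> = trace_mat (B * A)"
    unfolding trace_mat_def using assms by (simp add: mat_prod_index del: index_mult_mat(1))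
  finally show ?thesis .
qed

lemma trace_mat_diff:
  "dim_row A = dim_row B \<Longrightarrow> dim_col A = dim_col B \<Longrightarrow> dim_row A = dim_col A \<Longrightarrow>
   trace_mat (A - B) = trace_mat A - trace_mat (B :: real mat)"
  by (simp add: trace_mat_def sum_subtractf)

lemma trace_mat_add:
  "dim_row A = dim_row B \<Longrightarrow> dim_col A = dim_col B \<Longrightarrow> dim_row A = dim_col A \<Longrightarrow>
   trace_mat (A + B) = trace_mat A + trace_mat (B :: real mat)"
  by (simp add: trace_mat_def sum.distrib)

text \<open>The form in which norms of products with projections become computable, by cyclicity of the trace.\<close>

lemma frob_norm_sq_eq_trace: "(frob_norm A)\<^sup>2 = trace_mat (A * transpose_mat A)"
  unfolding frob_norm_def trace_mat_def
  by (subst real_sqrt_pow2) (auto simp: mat_prod_index power2_eq_square simp del: index_mult_mat(1) intro!: sum_nonneg)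

lemma frob_norm_eq_0D:
  assumes "frob_norm A = 0" and A: "A \<in> carrier_mat n m"
  shows "A = 0\<^sub>m n m"
proof -
  have "(\<Sum>i<n. \<Sum>j<m. (A $$ (i,j))\<^sup>2) = 0"
    using assms unfolding frob_norm_def by simp
  then have "\<forall>i\<in>{..<n}. (\<Sum>j<m. (A $$ (i,j))\<^sup>2) = 0"
    by (subst sum_nonneg_eq_0_iff[symmetric]) (auto intro: sum_nonneg)
  then have "A $$ (i,j) = 0" if "i < n" "j < m" for i j
    using that by (simp add: sum_nonneg_eq_0_iff)
  then show ?thesis using A by (intro eq_matI) auto
qed

lemma trace_gram_zero_imp_zero:
  fixes A :: "real mat"
  assumes "trace_mat (A * transpose_mat A) = 0" and "A \<in> carrier_mat n m"
  shows "A = 0\<^sub>m n m"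
  using assms(1) unfolding frob_norm_sq_eq_trace[symmetric]
  by (intro frob_norm_eq_0D[OF _ assms(2)]) simp

lemma trace_mat_zero [simp]: "trace_mat (0\<^sub>m n n) = 0"
  by (simp add: trace_mat_def)

section \<open>Functional calculus\<close>

lemma spec_mat_dim [simp]: "dim_row (spec_mat U f) = dim_row U" "dim_col (spec_mat U f) = dim_row U"
  by (simp_all add: spec_mat_def)

lemma mat_diag_dims [simp]: "dim_row (mat_diag n f) = n" "dim_col (mat_diag n f) = n"
  by (simp_all add: mat_diag_def)

lemma orthonormal_mat_dim: "orthonormal_mat U \<Longrightarrow> dim_col U = dim_row U"
  by (simp add: orthonormal_mat_def)

lemma orthonormal_mat_cancel:
  assumes "orthonormal_mat U" and "dim_row M = dim_row U"
  shows "transpose_mat U * (U * M) = M" "U * (transpose_mat U * M) = M"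
  using assms orthonormal_mat_dim[OF assms(1)]
  by (simp_all add: orthonormal_mat_def mat_one_mult flip: mat_assoc)

lemma spec_mat_mult:
  assumes U: "orthonormal_mat U"
  shows "spec_mat U f * spec_mat U g = spec_mat U (\<lambda>i. f i * g i)"
proof -
  have "spec_mat U f * spec_mat U g =
      U * (mat_diag (dim_row U) f * mat_diag (dim_row U) g * transpose_mat U)"
    unfolding spec_mat_def using orthonormal_mat_dim[OF U]
    by (simp add: mat_assoc orthonormal_mat_cancel[OF U] del: mat_diag_diag)
  then show ?thesis
    using orthonormal_mat_dim[OF U] by (simp add: spec_mat_def mat_assoc)
qed

lemma spec_mat_transpose:
  assumes U: "orthonormal_mat U"
  shows "transpose_mat (spec_mat U f) = spec_mat U f"
proof -
  have "transpose_mat (mat_diag (dim_row U) f) = mat_diag (dim_row U) f"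
    by (rule eq_matI) (auto simp: mat_diag_def)
  then show ?thesis
    using orthonormal_mat_dim[OF U] by (simp add: spec_mat_def mat_assoc mat_transpose_mult)
qed

lemma spec_mat_cong:
  assumes "\<And>i. i < dim_row U \<Longrightarrow> f i = g i"
  shows "spec_mat U f = spec_mat U g"
proof -
  have "mat_diag (dim_row U) f = mat_diag (dim_row U) g"
    by (rule eq_matI) (use assms in \<open>auto simp: mat_diag_def\<close>)
  then show ?thesis by (simp add: spec_mat_def)
qed

text \<open>The trace of a product with a diagonalised matrix weights the eigenvalues by the diagonal of the
  other factor, taken in the eigenbasis.\<close>

lemma trace_mult_spec_mat:
  assumes U: "orthonormal_mat U" and M: "M \<in> carrier_mat (dim_row U) (dim_row U)"
  shows "trace_mat (M * spec_mat U f) = (\<Sum>i<dim_row U. (transpose_mat U * M * U) $$ (i,i) * f i)"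
proof -
  note dims = orthonormal_mat_dim[OF U] carrier_matD[OF M]
  let ?D = "mat_diag (dim_row U) f"
  have "trace_mat (M * spec_mat U f) = trace_mat ((M * U * ?D) * transpose_mat U)"
    using dims by (simp add: spec_mat_def mat_assoc)
  also have "\<dots> = trace_mat ((transpose_mat U * M * U) * ?D)"
    using dims by (subst trace_mat_comm) (simp_all add: mat_assoc)
  also have "\<dots> = (\<Sum>i<dim_row U. (transpose_mat U * M * U) $$ (i,i) * f i)"
    using dims by (subst mat_diag_mult_right[of _ "dim_row U"]) (auto simp: trace_mat_def)
  finally show ?thesis .
qed

lemma trace_spec_mat:
  assumes U: "orthonormal_mat U"
  shows "trace_mat (spec_mat U f) = (\<Sum>i<dim_row U. f i)"
  using trace_mult_spec_mat[OF U, of "1\<^sub>m (dim_row U)" f] U orthonormal_mat_dim[OF U]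
  by (simp add: mat_one_mult mat_mult_one orthonormal_mat_def del: index_mult_mat(1))

section \<open>Positive semidefinite matrices and their square roots\<close>

lemma congruence_diag_entry:
  fixes B D :: "real mat"
  assumes "dim_col B = dim_row D" "dim_row B = dim_row D" "j < dim_col D"
  shows "(transpose_mat D * (B * D)) $$ (j,j) = col D j \<bullet> (B *\<^sub>v col D j)"
proof -
  have "col (B * D) j = B *\<^sub>v col D j"
    using assms by (intro eq_vecI) auto
  then show ?thesis using assms by simp
qed

text \<open>With \<open>v\<close> as a one-column matrix \<open>V\<close>, the quadratic form is the trace of \<open>V V\<^sup>T\<close> times the
  diagonalised matrix, hence a combination of the values \<open>f i\<close> whose weights are the diagonal entries
  of \<open>U\<^sup>T V (U\<^sup>T V)\<^sup>T\<close>. These are sums of squares.\<close>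

lemma psd_mat_spec_mat:
  assumes U: "orthonormal_mat U" and f: "\<And>i. i < dim_row U \<Longrightarrow> 0 \<le> f i"
  shows "psd_mat (spec_mat U f)"
  unfolding psd_mat_def
proof (intro conjI ballI)
  fix v :: "real vec" assume v: "v \<in> carrier_vec (dim_row (spec_mat U f))"
  have "v \<bullet> (spec_mat U f *\<^sub>v v) = trace_mat (mat_of_cols (dim_row U) [v] *
      transpose_mat (mat_of_cols (dim_row U) [v]) * spec_mat U f)" (is "_ = trace_mat (?V * _ * _)")
  proof -
    have "trace_mat (?V * transpose_mat ?V * spec_mat U f)
        = trace_mat (transpose_mat ?V * (spec_mat U f * ?V))"
      by (simp add: mat_assoc trace_mat_comm[of ?V])
    also have "\<dots> = v \<bullet> (spec_mat U f *\<^sub>v v)"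
      using v congruence_diag_entry[of "spec_mat U f" ?V 0] by (simp add: trace_mat_def)
    finally show ?thesis by simp
  qed
  also have "\<dots> = (\<Sum>i<dim_row U. (transpose_mat U * (?V * transpose_mat ?V) * U) $$ (i,i) * f i)"
    by (rule trace_mult_spec_mat[OF U]) auto
  also have "transpose_mat U * (?V * transpose_mat ?V) * U
      = (transpose_mat U * ?V) * transpose_mat (transpose_mat U * ?V)"
    by (simp add: mat_ring)
  also have "(\<Sum>i<dim_row U. ((transpose_mat U * ?V) * transpose_mat (transpose_mat U * ?V)) $$ (i,i) * f i) \<ge> 0"
    using f orthonormal_mat_dim[OF U]
    by (intro sum_nonneg mult_nonneg_nonneg) (auto simp: scalar_prod_def sum_nonneg)
  finally show "0 \<le> v \<bullet> (spec_mat U f *\<^sub>v v)" .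
qed (simp_all add: spec_mat_transpose[OF U])

lemma spec_mat_eigenvalue_nonneg:
  assumes U: "orthonormal_mat U" and psd: "psd_mat (spec_mat U f)" and i: "i < dim_row U"
  shows "0 \<le> f i"
proof -
  note dim = orthonormal_mat_dim[OF U]
  have "transpose_mat U * (spec_mat U f * U) = mat_diag (dim_row U) f"
    using dim U by (simp add: spec_mat_def mat_assoc orthonormal_mat_cancel[OF U])
      (simp add: orthonormal_mat_def mat_mult_one)
  then have "f i = col U i \<bullet> (spec_mat U f *\<^sub>v col U i)"
    using congruence_diag_entry[of "spec_mat U f" U i] dim i by (simp add: mat_diag_def)
  also have "\<dots> \<ge> 0" using psd i dim by (auto simp: psd_mat_def)
  finally show ?thesis .
qed

lemma psd_matD: "psd_mat B \<Longrightarrow> dim_col B = dim_row B" "psd_mat B \<Longrightarrow> transpose_mat B = B"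
  by (auto simp: psd_mat_def)

lemma psd_mat_spec:
  assumes psd: "psd_mat B"
  obtains U f where "orthonormal_mat U" "dim_row U = dim_row B" "B = spec_mat U f"
    and "\<And>i. i < dim_row U \<Longrightarrow> 0 \<le> f i"
proof -
  have "B \<in> carrier_mat (dim_row B) (dim_row B)" using psd_matD[OF psd] by auto
  from real_spectral_theorem[OF this psd_matD(2)[OF psd]]
  obtain U f where U: "U \<in> carrier_mat (dim_row B) (dim_row B)" "orthonormal_mat U"
    and B: "B = spec_mat U f"
    by blast
  show ?thesis
  proof (rule that[OF U(2) _ B])
    show "dim_row U = dim_row B" using U(1) by blast
    show "0 \<le> f i" if "i < dim_row U" for i
      using spec_mat_eigenvalue_nonneg[OF U(2) psd[unfolded B] that] .
  qed
qed

lemma psd_sqrt_exists: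
  assumes psd: "psd_mat B"
  obtains R where "dim_row R = dim_row B" "psd_mat R" "R * R = B"
proof -
  obtain U f where U: "orthonormal_mat U" "dim_row U = dim_row B" "B = spec_mat U f"
    and f: "\<And>i. i < dim_row U \<Longrightarrow> 0 \<le> f i" using psd_mat_spec[OF psd] by metis
  have "spec_mat U (\<lambda>i. sqrt (f i)) * spec_mat U (\<lambda>i. sqrt (f i)) = B"
    unfolding spec_mat_mult[OF U(1)] U(3) using f by (intro spec_mat_cong) simp
  then show ?thesis
    using that[of "spec_mat U (\<lambda>i. sqrt (f i))"] psd_mat_spec_mat[OF U(1), of "\<lambda>i. sqrt (f i)"] f U(2)
    by auto
qed

text \<open>With \<open>B = R\<^sup>2\<close> the trace is the squared Frobenius norm of \<open>R D\<close>; if it vanishes, so does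
  \<open>B D = R (R D)\<close>.\<close>

lemma psd_congruence_trace:
  assumes psd: "psd_mat B" and dim: "dim_row D = dim_row B"
  shows "0 \<le> trace_mat (transpose_mat D * (B * D))"
    and "trace_mat (transpose_mat D * (B * D)) = 0 \<Longrightarrow> B * D = 0\<^sub>m (dim_row B) (dim_col D)"
proof -
  obtain R where R: "dim_row R = dim_row B" "psd_mat R" "R * R = B"
    using psd_sqrt_exists[OF psd] .
  note dR = psd_matD[OF R(2)]
  have "transpose_mat D * (B * D) = transpose_mat D * ((R * R) * D)" by (simp add: R(3))
  also have "\<dots> = transpose_mat (R * D) * (R * D)"
    using R(1) dR dim by (simp add: mat_assoc mat_transpose_mult)
  finally have eq: "trace_mat (transpose_mat D * (B * D)) = trace_mat ((R * D) * transpose_mat (R * D))"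
    using R(1) dR dim by (simp add: trace_mat_comm)
  show "0 \<le> trace_mat (transpose_mat D * (B * D))"
    unfolding eq frob_norm_sq_eq_trace[symmetric] by simp
  assume "trace_mat (transpose_mat D * (B * D)) = 0"
  then have RD: "R * D = 0\<^sub>m (dim_row R) (dim_col D)"
    unfolding eq by (rule trace_gram_zero_imp_zero) auto
  have "B * D = (R * R) * D" by (simp add: R(3))
  also have "\<dots> = R * (R * D)" using R(1) dR dim by (simp add: mat_assoc)
  also have "\<dots> = 0\<^sub>m (dim_row B) (dim_col D)" unfolding RD using R(1) dR
    by (simp add: right_mult_zero_mat[of _ "dim_row B" "dim_row B"])
  finally show "B * D = 0\<^sub>m (dim_row B) (dim_col D)" .
qed

text \<open>Put \<open>D = B - C\<close>. Then \<open>B D + D C = B\<^sup>2 - C\<^sup>2 = 0\<close>; multiplying by \<open>D\<close> and taking traces, the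
  nonnegative numbers \<open>tr (D B D)\<close> and \<open>tr (D D C) = tr (D C D)\<close> add up to 0. So \<open>B D = C D = 0\<close>,
  and the difference of these products is \<open>D\<^sup>2 = D D\<^sup>T = 0\<close>.\<close>

lemma psd_sqrt_unique:
  assumes B: "psd_mat B" and C: "psd_mat C" and dim: "dim_row B = dim_row C" and eq: "B * B = C * C"
  shows "B = C"
proof -
  define D where "D = B - C"
  note dims = psd_matD[OF B] psd_matD[OF C] dim
  have D: "dim_row D = dim_row C" "dim_col D = dim_row C" "transpose_mat D = D"
    using dims by (auto simp: D_def mat_transpose_diff)
  have "B * D = (B * B) - B * C" using dims by (simp add: D_def mat_mult_diff)
  moreover have "D * C = B * C - C * C" using dims by (simp add: D_def mat_diff_mult)
  ultimately have "D * (B * D) + D * (D * C) = D * ((B * B) - B * C) + D * (B * C - C * C)" by simp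
  also have "\<dots> = 0\<^sub>m (dim_row C) (dim_row C)"
    using dims D by (simp add: mat_mult_diff eq) (auto intro!: eq_matI)
  finally have "trace_mat (D * (B * D) + D * (D * C)) = 0" by (simp add: trace_mat_def)
  then have "trace_mat (D * (B * D)) + trace_mat (D * (D * C)) = 0"
    using dims D by (subst (asm) trace_mat_add) auto
  moreover have "trace_mat (D * (D * C)) = trace_mat (D * (C * D))"
    using dims D by (subst trace_mat_comm) (simp_all add: mat_assoc)
  ultimately have sum0: "trace_mat (transpose_mat D * (B * D)) + trace_mat (transpose_mat D * (C * D)) = 0"
    using D by simp
  moreover have "0 \<le> trace_mat (transpose_mat D * (B * D))" "0 \<le> trace_mat (transpose_mat D * (C * D))"
    using psd_congruence_trace(1)[OF B, of D] psd_congruence_trace(1)[OF C, of D] D dim by simp_all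
  ultimately have "trace_mat (transpose_mat D * (B * D)) = 0" "trace_mat (transpose_mat D * (C * D)) = 0"
    by linarith+
  then have z: "B * D = 0\<^sub>m (dim_row C) (dim_row C)" "C * D = 0\<^sub>m (dim_row C) (dim_row C)"
    using psd_congruence_trace(2)[OF B, of D] psd_congruence_trace(2)[OF C, of D] D dim by simp_all
  have "D * D = B * D - C * D" using dims by (simp add: D_def mat_diff_mult)
  then have "trace_mat (D * transpose_mat D) = 0" using z D by (simp add: trace_mat_def)
  then have "D = 0\<^sub>m (dim_row C) (dim_row C)" using D by (intro trace_gram_zero_imp_zero) auto
  then have "(B - C) $$ (i,j) = 0" if "i < dim_row C" "j < dim_row C" for i j
    using that by (simp add: D_def[symmetric])
  then show ?thesis using dims by (intro eq_matI) auto
qed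

lemma sqrt_mat_eqI:
  assumes "psd_mat R" and "R * R = A" and "dim_row A = dim_row R"
  shows "sqrt_mat A = R"
  unfolding sqrt_mat_def
proof (rule the_equality)
  have "R \<in> carrier_mat (dim_row A) (dim_row A)"
    using assms(3) psd_matD(1)[OF assms(1)] by (intro carrier_matI) simp_all
  then show "R \<in> carrier_mat (dim_row A) (dim_row A) \<and> psd_mat R \<and> R * R = A"
    using assms(1,2) by blast
  fix B assume B: "B \<in> carrier_mat (dim_row A) (dim_row A) \<and> psd_mat B \<and> B * B = A"
  show "B = R"
    by (rule psd_sqrt_unique) (use B assms in auto)
qed

section \<open>The Moore--Penrose pseudo-inverse\<close>

text \<open>Symmetry of \<open>A B\<close> and \<open>A C\<close> lets the factors of \<open>A B = (A C) (A B)\<close> be exchanged, which gives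
  \<open>A B = A C\<close>; likewise \<open>B A = C A\<close>. Then \<open>B = B A B = C A C = C\<close>.\<close>

lemma is_pinv_unique:
  assumes B: "is_pinv A B" and C: "is_pinv A C"
  shows "B = C"
proof -
  have dims: "dim_row B = dim_col A" "dim_col B = dim_row A" "dim_row C = dim_col A" "dim_col C = dim_row A"
    and b: "A * B * A = A" "B * A * B = B" "transpose_mat (A * B) = A * B" "transpose_mat (B * A) = B * A"
    and c: "A * C * A = A" "C * A * C = C" "transpose_mat (A * C) = A * C" "transpose_mat (C * A) = C * A"
    using B C by (auto simp: is_pinv_def)
  have "A * B = (A * C * A) * B" by (simp add: c)
  also have "\<dots> = (A * C) * (A * B)" using dims by (simp add: mat_assoc)
  also have "\<dots> = transpose_mat (A * C) * transpose_mat (A * B)" by (simp only: b(3) c(3))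
  also have "\<dots> = transpose_mat ((A * B * A) * C)"
    using dims by (subst transpose_mult[symmetric, of _ "dim_row A" "dim_row A" _ "dim_row A"])
      (auto simp: mat_assoc)
  also have "\<dots> = A * C" by (simp add: b c)
  finally have AB: "A * B = A * C" .
  have "B * A = B * (A * C * A)" by (simp add: c)
  also have "\<dots> = (B * A) * (C * A)" using dims by (simp add: mat_assoc)
  also have "\<dots> = transpose_mat (B * A) * transpose_mat (C * A)" by (simp only: b(4) c(4))
  also have "\<dots> = transpose_mat (C * (A * B * A))"
    using dims by (subst transpose_mult[symmetric, of _ "dim_col A" "dim_col A" _ "dim_col A"])
      (auto simp: mat_assoc)
  also have "\<dots> = C * A" by (simp add: b c)
  finally have BA: "B * A = C * A" .
  have "B = (B * A) * B" by (simp add: b)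
  also have "\<dots> = C * (A * B)" unfolding BA using dims by (simp add: mat_assoc)
  also have "\<dots> = C * A * C" unfolding AB using dims by (simp add: mat_assoc)
  finally show ?thesis by (simp add: c)
qed

lemma pinv_eqI: "is_pinv A B \<Longrightarrow> pinv A = B"
  unfolding pinv_def by (rule the_equality) (auto intro: is_pinv_unique)

text \<open>Here \<open>inverse 0 = 0\<close> is what the pseudo-inverse requires on the kernel.\<close>

lemma is_pinv_spec_mat:
  assumes U: "orthonormal_mat U"
  shows "is_pinv (spec_mat U f) (spec_mat U (\<lambda>i. inverse (f i)))"
proof -
  have inverse_eqs: "f i * inverse (f i) * f i = f i"
    "inverse (f i) * f i * inverse (f i) = inverse (f i)" for i
    by (cases "f i = 0"; simp)+
  have "spec_mat U (\<lambda>i. f i * inverse (f i) * f i) = spec_mat U f"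
    "spec_mat U (\<lambda>i. inverse (f i) * f i * inverse (f i)) = spec_mat U (\<lambda>i. inverse (f i))"
    by (simp_all only: inverse_eqs)
  then show ?thesis
    by (auto simp: is_pinv_def spec_mat_mult[OF U] spec_mat_transpose[OF U])
qed

lemma psd_mat_gram: "psd_mat (Y * transpose_mat Y)"
  unfolding psd_mat_def
proof (intro conjI ballI)
  fix v :: "real vec" assume "v \<in> carrier_vec (dim_row (Y * transpose_mat Y))"
  then have v: "v \<in> carrier_vec (dim_row Y)" by simp
  have "v \<bullet> (Y *\<^sub>v (transpose_mat Y *\<^sub>v v)) = (transpose_mat Y *\<^sub>v v) \<bullet> (transpose_mat Y *\<^sub>v v)"
    using v mult_mat_vec_carrier[of "transpose_mat Y" "dim_col Y" "dim_row Y" v]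
    by (intro transpose_vec_mult_scalar[symmetric]) auto
  then have "v \<bullet> (Y * transpose_mat Y *\<^sub>v v) = (transpose_mat Y *\<^sub>v v) \<bullet> (transpose_mat Y *\<^sub>v v)"
    using v by (subst assoc_mult_mat_vec[of _ "dim_row Y" "dim_col Y" _ "dim_row Y"]) auto
  then show "0 \<le> v \<bullet> (Y * transpose_mat Y *\<^sub>v v)"
    by (simp add: scalar_prod_def sum_nonneg)
qed (simp_all add: mat_transpose_mult)

text \<open>Reduces the pseudo-inverse of an arbitrary matrix to that of the symmetric matrix \<open>M = Y Y\<^sup>T\<close>.
  Only \<open>M P Y = Y\<close> is more than a rearrangement: the difference \<open>E = (M P - 1) Y\<close> satisfies
  \<open>E Y\<^sup>T = M P M - M = 0\<close>, hence \<open>E E\<^sup>T = E Y\<^sup>T (M P - 1)\<^sup>T = 0\<close>.\<close>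

lemma is_pinv_via_gram:
  assumes P: "is_pinv (Y * transpose_mat Y) P" and sym: "transpose_mat P = P"
  shows "is_pinv Y (transpose_mat Y * P)"
proof -
  let ?M = "Y * transpose_mat Y"
  have dims: "dim_row P = dim_row Y" "dim_col P = dim_row Y"
    and p: "?M * P * ?M = ?M" "P * ?M * P = P" "transpose_mat (?M * P) = ?M * P"
    using P by (auto simp: is_pinv_def)
  define E where "E = ?M * P * Y - Y"
  have dE: "dim_row E = dim_row Y" "dim_col E = dim_col Y" by (auto simp: E_def)
  have "E * transpose_mat Y = ?M * P * ?M - ?M"
    unfolding E_def using dims by (simp add: mat_diff_mult mat_assoc)
  then have "E * transpose_mat Y = ?M - ?M" by (simp only: p)
  then have EY: "E * transpose_mat Y = 0\<^sub>m (dim_row Y) (dim_row Y)"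
    by (auto intro!: eq_matI)
  have "transpose_mat E = transpose_mat Y * transpose_mat (?M * P) - transpose_mat Y"
    unfolding E_def using dims by (simp add: mat_transpose_diff mat_transpose_mult mat_assoc)
  also have "transpose_mat Y * transpose_mat (?M * P) = transpose_mat Y * (?M * P)" by (simp only: p)
  finally have "E * transpose_mat E = E * transpose_mat Y * (?M * P) - E * transpose_mat Y"
    using dims dE by (simp add: mat_mult_diff mat_assoc)
  also have "\<dots> = 0\<^sub>m (dim_row E) (dim_row E)"
    unfolding EY using dims dE by (simp add: left_mult_zero_mat[of _ "dim_row Y" "dim_row Y"])
  finally have "trace_mat (E * transpose_mat E) = 0" by simp
  then have "E = 0\<^sub>m (dim_row Y) (dim_col Y)" using dE by (intro trace_gram_zero_imp_zero) auto
  then have "E $$ (i,j) = 0" if "i < dim_row Y" "j < dim_col Y" for i j using that by simp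
  then have MPY: "?M * P * Y = Y"
    by (intro eq_matI) (auto simp: E_def simp del: index_mult_mat(1))
  show ?thesis
    unfolding is_pinv_def
  proof (intro conjI)
    show "Y * (transpose_mat Y * P) * Y = Y" using MPY dims by (simp add: mat_assoc)
    have "transpose_mat Y * P * Y * (transpose_mat Y * P) = transpose_mat Y * (P * ?M * P)"
      using dims by (simp add: mat_assoc)
    then show "transpose_mat Y * P * Y * (transpose_mat Y * P) = transpose_mat Y * P"
      by (simp only: p)
    show "transpose_mat (Y * (transpose_mat Y * P)) = Y * (transpose_mat Y * P)"
      using p(3) dims by (simp add: mat_assoc)
    show "transpose_mat (transpose_mat Y * P * Y) = transpose_mat Y * P * Y"
      using dims by (simp add: mat_assoc mat_transpose_mult sym)
  qed (use dims in auto)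
qed

text \<open>The pseudo-inverse \<open>K\<close> of the square root of \<open>Y Y\<^sup>T\<close> and the pseudo-inverse of \<open>Y\<close> come from the
  same diagonalisation: \<open>K\<^sup>2\<close> is the pseudo-inverse of \<open>Y Y\<^sup>T\<close>.\<close>

lemma pinv_sqrt_gram_and_pinv:
  obtains K where "dim_row K = dim_row Y" "dim_col K = dim_row Y" "transpose_mat K = K"
    "pinv (sqrt_mat (Y * transpose_mat Y)) = K"
    "is_pinv Y (transpose_mat Y * (K * K))"
proof -
  obtain U f where U: "orthonormal_mat U" "dim_row U = dim_row (Y * transpose_mat Y)"
      "Y * transpose_mat Y = spec_mat U f"
    and f: "\<And>i. i < dim_row U \<Longrightarrow> 0 \<le> f i" using psd_mat_spec[OF psd_mat_gram[of Y]] by metis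
  define K where "K = spec_mat U (\<lambda>i. inverse (sqrt (f i)))"
  have "spec_mat U (\<lambda>i. sqrt (f i)) * spec_mat U (\<lambda>i. sqrt (f i)) = Y * transpose_mat Y"
    unfolding spec_mat_mult[OF U(1)] U(3) using f by (intro spec_mat_cong) simp
  then have "sqrt_mat (Y * transpose_mat Y) = spec_mat U (\<lambda>i. sqrt (f i))"
    using f U(2) by (intro sqrt_mat_eqI psd_mat_spec_mat[OF U(1)]) auto
  then have pK: "pinv (sqrt_mat (Y * transpose_mat Y)) = K"
    unfolding K_def by (simp add: pinv_eqI is_pinv_spec_mat[OF U(1)])
  have KK: "K * K = spec_mat U (\<lambda>i. inverse (f i))"
    unfolding K_def spec_mat_mult[OF U(1)]
    using f by (intro spec_mat_cong) (simp flip: inverse_mult_distrib)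
  have pY: "is_pinv Y (transpose_mat Y * (K * K))"
    unfolding KK
    by (rule is_pinv_via_gram) (simp_all add: U(3) is_pinv_spec_mat[OF U(1)] spec_mat_transpose[OF U(1)])
  have "dim_row U = dim_row Y" using U(2) by simp
  then have "dim_row K = dim_row Y" "dim_col K = dim_row Y" "transpose_mat K = K"
    by (simp_all add: K_def spec_mat_transpose[OF U(1)])
  then show ?thesis using pK pY by (rule that)
qed

lemma is_pinv_pinv: "is_pinv Y (pinv Y)"
  by (rule pinv_sqrt_gram_and_pinv[of Y]) (metis pinv_eqI)

text \<open>The square root disappears: \<open>T\<close> is the Gram matrix of \<open>X\<close> projected onto the row space of
  \<open>Y\<close>, so its leading eigenvectors are the leading left singular vectors of \<open>X Y\<^sup>\<dagger> Y\<close>.\<close>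

lemma T_mat_eq_proj:
  assumes "dim_col X = dim_col Y"
  shows "T_mat X Y = X * (pinv Y * Y) * transpose_mat X"
proof (rule pinv_sqrt_gram_and_pinv[of Y])
  fix K assume K: "dim_row K = dim_row Y" "dim_col K = dim_row Y" "transpose_mat K = K"
    and pK: "pinv (sqrt_mat (Y * transpose_mat Y)) = K"
    and KK: "is_pinv Y (transpose_mat Y * (K * K))"
  show ?thesis
    unfolding T_mat_def S_mat_def pK pinv_eqI[OF KK]
    using K assms by (simp add: mat_assoc mat_transpose_mult)
qed

section \<open>Orthogonal projections\<close>

definition orth_proj :: "nat \<Rightarrow> real mat \<Rightarrow> bool" where
  "orth_proj n P \<longleftrightarrow> P \<in> carrier_mat n n \<and> transpose_mat P = P \<and> P * P = P"

lemma orth_projD: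
  assumes "orth_proj n P"
  shows "dim_row P = n" "dim_col P = n" "transpose_mat P = P" "P * P = P"
  using assms by (auto simp: orth_proj_def)

lemma orth_proj_cancel:
  assumes "orth_proj n P" and "dim_row M = n"
  shows "P * (P * M) = P * M"
  using orth_projD[OF assms(1)] assms(2) by (simp flip: mat_assoc)

lemma mat_diff_self: "A - A = (0\<^sub>m (dim_row A) (dim_col A) :: real mat)"
  by (rule eq_matI) auto

lemma mat_diff_zero:
  "dim_row A = n \<Longrightarrow> dim_col A = k \<Longrightarrow> A - 0\<^sub>m n k = (A :: real mat)"
  by (rule eq_matI) auto

lemma orth_proj_compl:
  assumes P: "orth_proj n P"
  shows "orth_proj n (1\<^sub>m n - P)"
  using orth_projD[OF P] unfolding orth_proj_def
  by (auto simp: mat_ring mat_diff_self mat_diff_zero)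

text \<open>\<open>P = P P\<^sup>T\<close> makes the diagonal entry \<open>p\<close> a sum of squares that contains \<open>p\<^sup>2\<close>, so
  \<open>0 \<le> p\<close> and \<open>p\<^sup>2 \<le> p\<close>.\<close>

lemma orth_proj_diag_bounds:
  assumes P: "orth_proj n P" and i: "i < n"
  shows "0 \<le> P $$ (i,i)" "P $$ (i,i) \<le> 1"
proof -
  note p = orth_projD[OF P]
  have sym: "P $$ (l,i) = P $$ (i,l)" if "l < n" for l
    using arg_cong[OF p(3), of "\<lambda>M. M $$ (i,l)"] that p(1,2) i by simp
  have "P $$ (i,i) = (P * P) $$ (i,i)" by (simp only: p(4))
  also have "\<dots> = (\<Sum>l<n. P $$ (i,l) * P $$ (l,i))"
    using p(1,2) i by (subst mat_prod_index) auto
  also have "\<dots> = (\<Sum>l<n. (P $$ (i,l))\<^sup>2)" by (simp add: sym power2_eq_square)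
  finally have eq: "P $$ (i,i) = (\<Sum>l<n. (P $$ (i,l))\<^sup>2)" .
  show "0 \<le> P $$ (i,i)" unfolding eq by (intro sum_nonneg) auto
  have "(P $$ (i,i))\<^sup>2 \<le> P $$ (i,i)"
    unfolding eq using i by (subst eq[symmetric]) (intro member_le_sum, auto)
  show "P $$ (i,i) \<le> 1"
  proof (rule ccontr)
    assume "\<not> P $$ (i,i) \<le> 1"
    then have "P $$ (i,i) * 1 < P $$ (i,i) * P $$ (i,i)" by (intro mult_strict_left_mono) auto
    then show False using \<open>(P $$ (i,i))\<^sup>2 \<le> P $$ (i,i)\<close> by (simp add: power2_eq_square)
  qed
qed

lemma orth_proj_trace_le:
  assumes "orth_proj n P"
  shows "trace_mat P \<le> n"
proof -
  have "trace_mat P \<le> (\<Sum>i<n. 1)"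
    unfolding trace_mat_def orth_projD(1)[OF assms]
    by (rule sum_mono) (use orth_proj_diag_bounds[OF assms] in auto)
  then show ?thesis by simp
qed

lemma is_pinv_proj:
  assumes "is_pinv A B"
  shows "orth_proj (dim_row A) (A * B)" "orth_proj (dim_col A) (B * A)"
    "trace_mat (A * B) = trace_mat (B * A)"
proof -
  have dims: "dim_row B = dim_col A" "dim_col B = dim_row A"
    and b: "A * B * A = A" "B * A * B = B" "transpose_mat (A * B) = A * B" "transpose_mat (B * A) = B * A"
    using assms by (auto simp: is_pinv_def)
  have "A * B * (A * B) = A * B * A * B" "B * A * (B * A) = B * A * B * A"
    using dims by (simp_all add: mat_assoc)
  then have "A * B * (A * B) = A * B" "B * A * (B * A) = B * A"
    by (simp_all only: b)
  then show "orth_proj (dim_row A) (A * B)" "orth_proj (dim_col A) (B * A)"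
    unfolding orth_proj_def using b dims by auto
  show "trace_mat (A * B) = trace_mat (B * A)" using dims by (intro trace_mat_comm) auto
qed

text \<open>The trace, that is the rank, of the projection onto the column space of \<open>D\<close> is read off from the
  projection \<open>D\<^sup>\<dagger> D\<close>, which has only as many rows as \<open>D\<close> has columns.\<close>

lemma trace_proj_onto_columns_le:
  "trace_mat (D * pinv D) \<le> dim_col D"
  using is_pinv_proj[OF is_pinv_pinv[of D]] orth_proj_trace_le by metis

lemma frob_norm_sq_mult_proj:
  assumes P: "orth_proj (dim_col E) P"
  shows "(frob_norm (E * P))\<^sup>2 = trace_mat (E * P * transpose_mat E)"
  unfolding frob_norm_sq_eq_trace
  using orth_projD[OF P] by (simp add: mat_assoc mat_transpose_mult orth_proj_cancel[OF P])

lemma frob_norm_sq_proj_mult: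
  assumes P: "orth_proj (dim_row E) P"
  shows "(frob_norm (P * E))\<^sup>2 = trace_mat (P * (E * transpose_mat E))"
proof -
  note p = orth_projD[OF P]
  have "(frob_norm (P * E))\<^sup>2 = trace_mat ((P * (E * transpose_mat E)) * P)"
    unfolding frob_norm_sq_eq_trace using p by (simp add: mat_assoc mat_transpose_mult)
  also have "\<dots> = trace_mat (P * (P * (E * transpose_mat E)))"
    using p by (intro trace_mat_comm) auto
  finally show ?thesis using p by (simp add: orth_proj_cancel[OF P])
qed

lemma frob_norm_pythagoras_right:
  assumes P: "orth_proj (dim_col E) P"
  shows "(frob_norm E)\<^sup>2 = (frob_norm (E * P))\<^sup>2 + (frob_norm (E * (1\<^sub>m (dim_col E) - P)))\<^sup>2"
proof -
  note p = orth_projD[OF P]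
  have "trace_mat (E * (1\<^sub>m (dim_col E) - P) * transpose_mat E)
      = trace_mat (E * transpose_mat E) - trace_mat (E * P * transpose_mat E)"
    using p by (subst trace_mat_diff[symmetric]) (auto simp: mat_ring)
  then show ?thesis
    using frob_norm_sq_mult_proj[OF P] frob_norm_sq_mult_proj[OF orth_proj_compl[OF P]]
    by (simp add: frob_norm_sq_eq_trace)
qed

lemma frob_norm_sq_compl_proj_mult:
  assumes P: "orth_proj (dim_row E) P"
  shows "(frob_norm ((1\<^sub>m (dim_row E) - P) * E))\<^sup>2
    = trace_mat (E * transpose_mat E) - trace_mat (P * (E * transpose_mat E))"
  using orth_projD[OF P]
  by (subst frob_norm_sq_proj_mult[OF orth_proj_compl[OF P]], subst trace_mat_diff[symmetric])
    (auto simp: mat_ring)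

lemma frob_norm_compl_proj_mult_le:
  assumes P: "orth_proj (dim_row E) P"
  shows "(frob_norm ((1\<^sub>m (dim_row E) - P) * E))\<^sup>2 \<le> (frob_norm E)\<^sup>2"
proof -
  have "0 \<le> trace_mat (P * (E * transpose_mat E))"
    unfolding frob_norm_sq_proj_mult[OF P, symmetric] by simp
  then show ?thesis
    unfolding frob_norm_sq_compl_proj_mult[OF P] by (simp add: frob_norm_sq_eq_trace[of E])
qed

section \<open>Best approximation of given rank\<close>

text \<open>Subtract the threshold \<open>c = \<sigma> (k - 1)\<close> from every \<open>\<sigma> i\<close>. Then the first \<open>k\<close> terms are nonnegative
  and the others nonpositive, so weight 1 on the head and 0 on the tail is the best choice; the total
  weight restores \<open>c\<close> at most \<open>k\<close> times.\<close>

lemma weighted_sum_le_head_sum: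
  fixes \<sigma> w :: "nat \<Rightarrow> real"
  assumes k: "0 < k" "k \<le> n"
    and nonneg: "\<And>i. i < n \<Longrightarrow> 0 \<le> \<sigma> i"
    and dec: "\<And>i j. i \<le> j \<Longrightarrow> j < n \<Longrightarrow> \<sigma> j \<le> \<sigma> i"
    and w: "\<And>i. i < n \<Longrightarrow> 0 \<le> w i \<and> w i \<le> 1"
    and sum_w: "(\<Sum>i<n. w i) \<le> k"
  shows "(\<Sum>i<n. w i * \<sigma> i) \<le> (\<Sum>i<k. \<sigma> i)"
proof -
  let ?c = "\<sigma> (k - 1)"
  have "(\<Sum>i<n. w i * (\<sigma> i - ?c)) \<le> (\<Sum>i<n. if i < k then \<sigma> i - ?c else 0)"
  proof (rule sum_mono)
    fix i assume "i \<in> {..<n}"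
    then have i: "i < n" by simp
    show "w i * (\<sigma> i - ?c) \<le> (if i < k then \<sigma> i - ?c else 0)"
    proof (cases "i < k")
      case True
      then have "?c \<le> \<sigma> i" using k by (intro dec) auto
      then show ?thesis using True w[OF i] by (simp add: mult_left_le_one_le)
    next
      case False
      then have "\<sigma> i \<le> ?c" using i by (intro dec) auto
      then show ?thesis using False w[OF i] by (simp add: mult_nonneg_nonpos)
    qed
  qed
  also have "\<dots> = (\<Sum>i<k. \<sigma> i - ?c)"
    using k by (intro sum.mono_neutral_cong_right) auto
  finally have "(\<Sum>i<n. w i * \<sigma> i) - (\<Sum>i<n. w i) * ?c \<le> (\<Sum>i<k. \<sigma> i) - k * ?c"
    by (simp add: right_diff_distrib sum_subtractf sum_distrib_right)
  moreover have "(\<Sum>i<n. w i) * ?c \<le> k * ?c"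
    using sum_w nonneg[of "k - 1"] k by (intro mult_right_mono) auto
  ultimately show ?thesis by linarith
qed

lemma first_cols_proj:
  assumes "U \<in> carrier_mat m m" and "k \<le> m"
  shows "first_cols U k * transpose_mat (first_cols U k) = spec_mat U (\<lambda>i. if i < k then 1 else 0)"
proof (rule eq_matI)
  note dU = carrier_matD[OF assms(1)]
  fix i j
  assume "i < dim_row (spec_mat U (\<lambda>i. if i < k then 1 else 0))"
    "j < dim_col (spec_mat U (\<lambda>i. if i < k then 1 else 0))"
  then have ij: "i < m" "j < m" using dU by auto
  have "(first_cols U k * transpose_mat (first_cols U k)) $$ (i,j) = (\<Sum>l<k. U $$ (i,l) * U $$ (j,l))"
    using ij dU by (subst mat_prod_index) (auto simp: first_cols_def)
  also have "\<dots> = (\<Sum>l<m. U $$ (i,l) * (if l < k then 1 else 0) * U $$ (j,l))"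
    using assms(2) by (intro sum.mono_neutral_cong_left) auto
  also have "\<dots> = spec_mat U (\<lambda>i. if i < k then 1 else 0) $$ (i,j)"
    unfolding spec_mat_def dU mat_diag_mult_right[OF assms(1)]
    using ij dU by (subst mat_prod_index) auto
  finally show "(first_cols U k * transpose_mat (first_cols U k)) $$ (i,j)
      = spec_mat U (\<lambda>i. if i < k then 1 else 0) $$ (i,j)" .
qed (use assms in \<open>auto simp: first_cols_def\<close>)

text \<open>Let \<open>\<Pi> = D D\<^sup>\<dagger>\<close> be the projection onto the columns of \<open>D\<close>. Since \<open>1 - \<Pi>\<close> annihilates
  \<open>D C\<close> and does not increase the norm, the error of \<open>D C\<close> is at least the squared norm of
  \<open>(1 - \<Pi>) M\<close>, which is \<open>tr (M M\<^sup>T) - tr (\<Pi> M M\<^sup>T)\<close>. In the eigenbasis the second trace is a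
  combination of the \<open>\<sigma> i\<close> with weights in \<open>[0,1]\<close> of total at most \<open>k\<close>, hence at most the sum of the
  \<open>k\<close> largest. For the projection onto the first \<open>k\<close> eigenvectors this bound is attained.\<close>

theorem eckart_young:
  assumes U: "orthonormal_mat U" "U \<in> carrier_mat m m"
    and M: "M * transpose_mat M = spec_mat U \<sigma>" and dM: "M \<in> carrier_mat m s"
    and nonneg: "\<And>i. i < m \<Longrightarrow> 0 \<le> \<sigma> i"
    and dec: "\<And>i j. i \<le> j \<Longrightarrow> j < m \<Longrightarrow> \<sigma> j \<le> \<sigma> i"
    and k: "0 < k" "k \<le> m"
    and D: "D \<in> carrier_mat m k" and C: "C \<in> carrier_mat k s"
  shows "(frob_norm (M - first_cols U k * transpose_mat (first_cols U k) * M))\<^sup>2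
      \<le> (frob_norm (M - D * C))\<^sup>2"
proof -
  note dU = carrier_matD[OF U(2)] and dM' = carrier_matD[OF dM]
    and dD = carrier_matD[OF D] and dC = carrier_matD[OF C]
  let ?h = "\<lambda>i. if i < k then 1 else 0 :: real"
  let ?H = "spec_mat U ?h"
  have H: "orth_proj (dim_row M) ?H"
    unfolding orth_proj_def using dU dM'
    by (auto simp: spec_mat_transpose[OF U(1)] spec_mat_mult[OF U(1)] intro!: spec_mat_cong)
  have "M - first_cols U k * transpose_mat (first_cols U k) * M = (1\<^sub>m (dim_row M) - ?H) * M"
    unfolding first_cols_proj[OF U(2) k(2)] using dU dM' by (simp add: mat_ring)
  then have lhs: "(frob_norm (M - first_cols U k * transpose_mat (first_cols U k) * M))\<^sup>2
      = trace_mat (M * transpose_mat M) - (\<Sum>i<k. \<sigma> i)"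
  proof -
    have "trace_mat (?H * (M * transpose_mat M)) = (\<Sum>i<m. ?h i * \<sigma> i)"
      unfolding M spec_mat_mult[OF U(1)] trace_spec_mat[OF U(1)] dU ..
    also have "\<dots> = (\<Sum>i<k. \<sigma> i)"
      using k by (intro sum.mono_neutral_cong_right) auto
    finally show ?thesis
      unfolding \<open>M - _ = _\<close> frob_norm_sq_compl_proj_mult[OF H] by simp
  qed
  let ?P = "D * pinv D"
  have P: "orth_proj m ?P" using is_pinv_proj(1)[OF is_pinv_pinv[of D]] dD by simp
  note p = orth_projD[OF P]
  have PD: "?P * D = D" using is_pinv_pinv[of D] by (simp add: is_pinv_def)
  have "(1\<^sub>m m - ?P) * (M - D * C) = M - ?P * M - (D * C - (?P * D) * C)"
    using p(1,2) dM' dD dC by (simp add: mat_diff_mult mat_mult_diff mat_one_mult) (simp add: mat_assoc)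
  also have "\<dots> = M - ?P * M"
    unfolding PD using p(1,2) dM' dD dC by (simp add: mat_diff_self mat_diff_zero)
  also have "\<dots> = (1\<^sub>m m - ?P) * M"
    using p(1,2) dM' by (simp add: mat_diff_mult mat_one_mult)
  finally have cancel: "(1\<^sub>m m - ?P) * (M - D * C) = (1\<^sub>m m - ?P) * M" .
  let ?W = "transpose_mat U * ?P * U"
  have W: "orth_proj m ?W"
  proof -
    have "?W * ?W = transpose_mat U * (?P * ?P) * U"
      using dU p(1,2) by (simp add: mat_assoc orthonormal_mat_cancel[OF U(1)])
    then show ?thesis
      unfolding orth_proj_def p(4) using dU p
      by (auto simp: mat_transpose_mult mat_assoc)
  qed
  have "trace_mat ?W = trace_mat (U * (transpose_mat U * ?P))"
    using dU p(1,2) by (intro trace_mat_comm) auto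
  also have "\<dots> = trace_mat ?P" using dU p(1,2) by (simp add: orthonormal_mat_cancel[OF U(1)])
  finally have "trace_mat ?W \<le> k" using trace_proj_onto_columns_le[of D] dD by simp
  then have sum_w: "(\<Sum>i<m. ?W $$ (i,i)) \<le> k"
    unfolding trace_mat_def orth_projD(1)[OF W] .
  have "trace_mat (?P * (M * transpose_mat M)) = (\<Sum>i<m. ?W $$ (i,i) * \<sigma> i)"
    unfolding M using dU p(1,2) by (subst trace_mult_spec_mat[OF U(1)]) auto
  also have "\<dots> \<le> (\<Sum>i<k. \<sigma> i)"
    using k nonneg dec orth_proj_diag_bounds[OF W] sum_w
    by (intro weighted_sum_le_head_sum) auto
  finally have "(frob_norm (M - first_cols U k * transpose_mat (first_cols U k) * M))\<^sup>2
      \<le> trace_mat (M * transpose_mat M) - trace_mat (?P * (M * transpose_mat M))"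
    unfolding lhs by simp
  also have "\<dots> = (frob_norm ((1\<^sub>m m - ?P) * M))\<^sup>2"
    using frob_norm_sq_compl_proj_mult[of M ?P] P dM' by simp
  also have "\<dots> \<le> (frob_norm (M - D * C))\<^sup>2"
    using frob_norm_compl_proj_mult_le[of "M - D * C" ?P] P dD by (simp only: cancel[symmetric]) simp
  finally show ?thesis .
qed

text \<open>In a singular value decomposition of a positive semidefinite matrix the right factor may differ
  from the left one on the kernel, so \<open>U = V\<close> cannot be concluded. But \<open>T\<^sup>2 = T T\<^sup>T\<close> does not see \<open>V\<close>:
  it is the square of \<open>U \<Sigma> U\<^sup>T\<close>, and uniqueness of the positive semidefinite root identifies the
  two.\<close>

lemma psd_mat_svd:
  assumes T: "psd_mat T" and svd: "is_svd T U \<Sigma> V"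
  shows "T = spec_mat U (\<lambda>i. \<Sigma> $$ (i,i))"
proof -
  let ?\<sigma> = "\<lambda>i. \<Sigma> $$ (i,i)"
  note dT = psd_matD[OF T]
  have carriers: "U \<in> carrier_mat (dim_row T) (dim_row T)" "V \<in> carrier_mat (dim_row T) (dim_row T)"
    and orth: "orthonormal_mat U" "orthonormal_mat V"
    and S: "\<Sigma> \<in> carrier_mat (dim_row T) (dim_row T)" "diagonal_mat \<Sigma>"
    and nonneg: "\<And>i. i < dim_row T \<Longrightarrow> 0 \<le> \<Sigma> $$ (i,i)"
    and eq: "T = U * \<Sigma> * transpose_mat V"
    using svd unfolding is_svd_def dT(1) min.idem by blast+
  note U = orth(1) carrier_matD[OF carriers(1)] and V = orth(2) carrier_matD[OF carriers(2)]
  define D where "D = mat_diag (dim_row U) ?\<sigma>"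
  have SD: "\<Sigma> = D"
    unfolding D_def by (rule eq_matI) (use S U in \<open>auto simp: mat_diag_def diagonal_mat_def\<close>)
  have Dt: "transpose_mat D = D" unfolding D_def by (rule eq_matI) (auto simp: mat_diag_def)
  have dD: "dim_row D = dim_row U" "dim_col D = dim_row U" by (simp_all add: D_def)
  have "T * T = T * transpose_mat T" by (simp only: dT(2))
  also have "\<dots> = (U * D * transpose_mat V) * transpose_mat (U * D * transpose_mat V)"
    by (simp only: eq[unfolded SD, symmetric])
  also have "\<dots> = U * (D * (transpose_mat V * (V * (D * transpose_mat U))))"
    using U V dD by (simp add: mat_assoc mat_transpose_mult Dt)
  also have "\<dots> = U * (D * (D * transpose_mat U))"
    using U(2,3) V(2,3) dD by (simp add: orthonormal_mat_cancel[OF V(1)])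
  also have "\<dots> = (U * D * transpose_mat U) * (U * D * transpose_mat U)"
    using U(2,3) dD by (simp add: mat_assoc orthonormal_mat_cancel[OF U(1)])
  finally have "T * T = spec_mat U ?\<sigma> * spec_mat U ?\<sigma>" by (simp add: spec_mat_def D_def)
  moreover have "psd_mat (spec_mat U ?\<sigma>)" using U nonneg by (intro psd_mat_spec_mat) auto
  ultimately show ?thesis using psd_sqrt_unique[OF T] U(2) by simp
qed

text \<open>Eckart--Young for \<open>M = X Y\<^sup>\<dagger> Y\<close>, whose Gram matrix is \<open>T\<close>. The competitors
  \<open>D C\<close> range over all matrices of rank at most \<open>k\<close>; that the optimal one ends in the factor \<open>Y\<close>
  is due to the factor \<open>Y\<close> at the right of \<open>M\<close>.\<close>

lemma low_rank_fit_optimal: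
  fixes Y :: "real mat"
  assumes X: "X \<in> carrier_mat m s" and Y: "Y \<in> carrier_mat n s"
    and svd: "is_svd (T_mat X Y) U \<Sigma> V" and k: "0 < k" "k \<le> m"
    and D: "D \<in> carrier_mat m k" and C: "C \<in> carrier_mat k s"
  shows "(frob_norm (X * (pinv Y * Y) - first_cols U k * (transpose_mat (first_cols U k) * X * pinv Y) * Y))\<^sup>2
      \<le> (frob_norm (X * (pinv Y * Y) - D * C))\<^sup>2"
proof -
  let ?P = "pinv Y * Y" and ?M = "X * (pinv Y * Y)"
  note dX = carrier_matD[OF X] and dY = carrier_matD[OF Y]
  have P: "orth_proj s ?P" using is_pinv_proj(2)[OF is_pinv_pinv[of Y]] dY by simp
  note p = orth_projD[OF P]
  have dpinv: "dim_row (pinv Y) = s" "dim_col (pinv Y) = n"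
    using is_pinv_pinv[of Y] dY by (auto simp: is_pinv_def)
  have T: "T_mat X Y = ?M * transpose_mat ?M"
  proof -
    have "?M * transpose_mat ?M = X * (?P * (transpose_mat ?P * transpose_mat X))"
      using p(1,2) dX by (simp add: mat_assoc mat_transpose_mult)
    also have "\<dots> = X * ((?P * ?P) * transpose_mat X)"
      unfolding p(3) using p(1,2) dX by (simp add: mat_assoc)
    also have "\<dots> = T_mat X Y"
      using T_mat_eq_proj[of X Y] p(1,2,4) dX dY by (simp add: mat_assoc)
    finally show ?thesis ..
  qed
  then have psd: "psd_mat (T_mat X Y)" by (simp only: psd_mat_gram)
  have dT: "dim_row (T_mat X Y) = m" "dim_col (T_mat X Y) = m"
    unfolding T using dX by simp_all
  have U: "orthonormal_mat U" "U \<in> carrier_mat m m"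
    and nonneg: "\<And>i. i < m \<Longrightarrow> 0 \<le> \<Sigma> $$ (i,i)"
    and dec: "\<And>i j. i \<le> j \<Longrightarrow> j < m \<Longrightarrow> \<Sigma> $$ (j,j) \<le> \<Sigma> $$ (i,i)"
    using svd unfolding is_svd_def dT min.idem by blast+
  have "?M * transpose_mat ?M = spec_mat U (\<lambda>i. \<Sigma> $$ (i,i))"
    unfolding T[symmetric] by (rule psd_mat_svd[OF psd svd])
  moreover have "?M \<in> carrier_mat m s" using dX p(1,2) by auto
  ultimately have "(frob_norm (?M - first_cols U k * transpose_mat (first_cols U k) * ?M))\<^sup>2
      \<le> (frob_norm (?M - D * C))\<^sup>2"
    using eckart_young[OF U _ _ _ _ k D C, of ?M "\<lambda>i. \<Sigma> $$ (i,i)"] nonneg dec by blast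
  moreover have "first_cols U k * transpose_mat (first_cols U k) * ?M
      = first_cols U k * (transpose_mat (first_cols U k) * X * pinv Y) * Y"
    using U(2) dX dY dpinv by (simp add: mat_assoc first_cols_def)
  ultimately show ?thesis by simp
qed

section \<open>Separation of the two approximation problems\<close>

lemma orth_proj_mult_zero_commute:
  assumes P: "orth_proj n P" and Q: "orth_proj n Q" and "Q * P = 0\<^sub>m n n"
  shows "P * Q = 0\<^sub>m n n"
proof -
  note p = orth_projD[OF P] and q = orth_projD[OF Q]
  have "transpose_mat (Q * P) = P * Q" using p(1,2) q(1,2) by (simp add: mat_transpose_mult p(3) q(3))
  then show ?thesis using assms(3) by simp
qed

lemma mat_zero_mult: "dim_row A = k \<Longrightarrow> 0\<^sub>m n k * A = 0\<^sub>m n (dim_col (A :: real mat))"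
  by (rule left_mult_zero_mat) auto

lemma mat_mult_zero: "dim_col A = k \<Longrightarrow> A * 0\<^sub>m k n = 0\<^sub>m (dim_row (A :: real mat)) n"
  by (rule right_mult_zero_mat) auto

text \<open>Two applications of Pythagoras, first along \<open>P\<close> and then along \<open>Q\<close>. As \<open>A\<close> lives on the range
  of \<open>P\<close>, \<open>B\<close> on that of \<open>Q\<close>, and \<open>P Q = Q P = 0\<close>, each piece of the residual sees at most one of
  them, and the last one sees neither.\<close>

lemma frob_norm_orthogonal_split:
  assumes P: "orth_proj s P" and Q: "orth_proj s Q" and QP: "Q * P = 0\<^sub>m s s"
    and X: "X \<in> carrier_mat m s" and A: "A \<in> carrier_mat m s" and B: "B \<in> carrier_mat m s"
    and AP: "A * P = A" and BQ: "B * Q = B"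
  shows "(frob_norm (X - (A + B)))\<^sup>2 = (frob_norm (X * P - A))\<^sup>2 + (frob_norm (X * Q - B))\<^sup>2
    + (frob_norm (X * ((1\<^sub>m s - P) * (1\<^sub>m s - Q))))\<^sup>2"
proof -
  note p = orth_projD[OF P] and q = orth_projD[OF Q]
    and d = carrier_matD[OF X] carrier_matD[OF A] carrier_matD[OF B]
  note PQ = orth_proj_mult_zero_commute[OF P Q QP]
  let ?R = "(1\<^sub>m s - P) * (1\<^sub>m s - Q)"
  define E where "E = X - (A + B)"
  have dE: "dim_row E = m" "dim_col E = s" using d by (auto simp: E_def)
  have mult_E: "E * M = X * M - (A * M + B * M)" if "M \<in> carrier_mat s s" for M
    unfolding E_def using X A B that
    by (simp add: minus_mult_distrib_mat[of _ m s] add_mult_distrib_mat[of _ m s])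
  have AQ: "A * Q = 0\<^sub>m m s"
  proof -
    have "A * Q = (A * P) * Q" by (simp only: AP)
    also have "\<dots> = 0\<^sub>m m s" using d p(1,2) q(1,2) by (simp add: mat_assoc PQ mat_mult_zero)
    finally show ?thesis .
  qed
  have BP: "B * P = 0\<^sub>m m s"
  proof -
    have "B * P = (B * Q) * P" by (simp only: BQ)
    also have "\<dots> = 0\<^sub>m m s" using d p(1,2) q(1,2) by (simp add: mat_assoc QP mat_mult_zero)
    finally show ?thesis .
  qed
  have "E * P = X * P - A"
    using mult_E[of P] P A B by (simp add: orth_proj_def AP BP)
  moreover have "E * Q = X * Q - B"
    using mult_E[of Q] Q A B by (simp add: orth_proj_def AQ BQ)
  moreover have "(1\<^sub>m s - P) * Q = Q"
    using p(1,2) q(1,2) by (simp add: mat_ring PQ mat_diff_zero)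
  moreover have "E * ?R = X * ?R"
  proof -
    have R: "?R \<in> carrier_mat s s" using p(1,2) q(1,2) by auto
    have "A * ?R = (A * (1\<^sub>m s - P)) * (1\<^sub>m s - Q)" using p(1,2) q(1,2) d by (simp add: mat_assoc)
    also have "A * (1\<^sub>m s - P) = 0\<^sub>m m s" using p(1,2) d by (simp add: mat_mult_diff mat_mult_one AP mat_diff_self)
    finally have "A * ?R = 0\<^sub>m m s" using q(1,2) by (simp add: mat_zero_mult)
    moreover
    have "B * ?R = (B * (1\<^sub>m s - P)) * (1\<^sub>m s - Q)" using p(1,2) q(1,2) d by (simp add: mat_assoc)
    then have "B * ?R = B * (1\<^sub>m s - Q)"
      using p(1,2) d by (simp add: mat_mult_diff mat_mult_one BP mat_diff_zero)
    then have "B * ?R = 0\<^sub>m m s" using q(1,2) d by (simp add: mat_mult_diff mat_mult_one BQ mat_diff_self)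
    ultimately show ?thesis using mult_E[OF R] d q(1,2) by (simp add: mat_diff_zero)
  qed
  moreover have "(frob_norm E)\<^sup>2 = (frob_norm (E * P))\<^sup>2
      + ((frob_norm (E * (1\<^sub>m s - P) * Q))\<^sup>2 + (frob_norm (E * (1\<^sub>m s - P) * (1\<^sub>m s - Q)))\<^sup>2)"
    using frob_norm_pythagoras_right[of E P] frob_norm_pythagoras_right[of "E * (1\<^sub>m s - P)" Q]
      P Q dE p(2) by simp
  moreover have "E * (1\<^sub>m s - P) * Q = E * ((1\<^sub>m s - P) * Q)" "E * (1\<^sub>m s - P) * (1\<^sub>m s - Q) = E * ?R"
    using dE p(1,2) q(1,2) by (simp_all add: mat_assoc)
  ultimately show ?thesis by (simp add: E_def[symmetric])
qed

theorem theorem1: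
  fixes m n s q k k1 k2 :: nat
    and X Y V0 G Z0 U_Y \<Sigma>_Y V_Y U_Z \<Sigma>_Z V_Z :: "real mat"
  assumes "X \<in> carrier_mat m s" and "Y \<in> carrier_mat n s" and "V0 \<in> carrier_mat q s"
    and "0 < k1" and "0 < k2" and "k1 + k2 = k" and "k \<le> min m n"
    and "G = 1\<^sub>m s - pinv Y * Y" and "Z0 = V0 * G"
    and "is_svd (T_mat X Y) U_Y \<Sigma>_Y V_Y"
    and "is_svd (T_mat X Z0) U_Z \<Sigma>_Z V_Z"
  shows "is_arg_min
    (\<lambda>((D1, C1), (D2, C2)). (frob_norm (X - (D1 * C1 * Y + D2 * C2 * Z0)))\<^sup>2)
    (\<lambda>((D1, C1), (D2, C2)).
       (D1 \<in> carrier_mat m k1 \<and> C1 \<in> carrier_mat k1 n) \<and>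
       (D2 \<in> carrier_mat m k2 \<and> C2 \<in> carrier_mat k2 q))
    ((first_cols U_Y k1, transpose_mat (first_cols U_Y k1) * X * pinv Y),
     (first_cols U_Z k2, transpose_mat (first_cols U_Z k2) * X * pinv Z0))"
proof -
  note X = assms(1) and Y = assms(2) and V0 = assms(3)
  let ?P = "pinv Y * Y" and ?Q = "pinv Z0 * Z0"
  have pY: "pinv Y \<in> carrier_mat s n" "Y * ?P = Y"
    using is_pinv_pinv[of Y] Y by (auto simp: is_pinv_def mat_assoc)
  have P: "orth_proj s ?P" using is_pinv_proj(2)[OF is_pinv_pinv[of Y]] Y by simp
  note p = orth_projD[OF P]
  have Z0: "Z0 \<in> carrier_mat q s" using V0 p(1,2) by (auto simp: assms(8,9))
  have pZ: "pinv Z0 \<in> carrier_mat s q" "Z0 * ?Q = Z0"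
    using is_pinv_pinv[of Z0] Z0 by (auto simp: is_pinv_def mat_assoc)
  have Q: "orth_proj s ?Q" using is_pinv_proj(2)[OF is_pinv_pinv[of Z0]] Z0 by simp
  \<comment> \<open>\<open>G\<close> projects onto the complement of the row space of \<open>Y\<close>, so the two row spaces are
    orthogonal.\<close>
  have "G * ?P = 0\<^sub>m s s"
    unfolding assms(8) using p(1,2)
    by (simp only: mat_diff_mult mat_one_mult p(4) index_one_mat) (simp add: mat_diff_self p)
  then have "Z0 * ?P = 0\<^sub>m q s"
    unfolding assms(9) using V0 p(1,2) mat_assoc[of V0 G ?P] by (simp add: assms(8) mat_mult_zero)
  then have QP: "?Q * ?P = 0\<^sub>m s s"
    using pZ(1) Z0 p(1,2) mat_assoc[of "pinv Z0" Z0 ?P] by (simp add: mat_mult_zero)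
  let ?c = "(frob_norm (X * ((1\<^sub>m s - ?P) * (1\<^sub>m s - ?Q))))\<^sup>2"
  have split: "(frob_norm (X - (D1 * C1 * Y + D2 * C2 * Z0)))\<^sup>2
      = (frob_norm (X * ?P - D1 * C1 * Y))\<^sup>2 + (frob_norm (X * ?Q - D2 * C2 * Z0))\<^sup>2 + ?c"
    if "D1 \<in> carrier_mat m k1" "C1 \<in> carrier_mat k1 n" "D2 \<in> carrier_mat m k2" "C2 \<in> carrier_mat k2 q"
    for D1 C1 D2 C2
  proof (rule frob_norm_orthogonal_split[OF P Q QP X])
    show "D1 * C1 * Y \<in> carrier_mat m s" "D2 * C2 * Z0 \<in> carrier_mat m s"
      using that Y Z0 by auto
    have "D1 * C1 * Y * ?P = D1 * C1 * (Y * ?P)" "D2 * C2 * Z0 * ?Q = D2 * C2 * (Z0 * ?Q)"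
      by (rule mat_assoc; use that Y Z0 pY(1) pZ(1) in simp)+
    then show "D1 * C1 * Y * ?P = D1 * C1 * Y" "D2 * C2 * Z0 * ?Q = D2 * C2 * Z0"
      by (simp_all only: pY(2) pZ(2))
  qed
  have k: "k1 \<le> m" "k2 \<le> m" using assms(6,7) by auto
  let ?D1 = "first_cols U_Y k1" and ?D2 = "first_cols U_Z k2"
  let ?C1 = "transpose_mat ?D1 * X * pinv Y" and ?C2 = "transpose_mat ?D2 * X * pinv Z0"
  have "dim_row U_Y = m" "dim_row U_Z = m"
    using assms(10,11) X by (auto simp: is_svd_def T_mat_def S_mat_def)
  then have cand: "?D1 \<in> carrier_mat m k1" "?C1 \<in> carrier_mat k1 n"
    "?D2 \<in> carrier_mat m k2" "?C2 \<in> carrier_mat k2 q"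
    using X pY(1) pZ(1) by (auto simp: first_cols_def)
  have "(frob_norm (X - (?D1 * ?C1 * Y + ?D2 * ?C2 * Z0)))\<^sup>2
      \<le> (frob_norm (X - (D1 * C1 * Y + D2 * C2 * Z0)))\<^sup>2"
    if DC: "D1 \<in> carrier_mat m k1" "C1 \<in> carrier_mat k1 n" "D2 \<in> carrier_mat m k2" "C2 \<in> carrier_mat k2 q"
    for D1 C1 D2 C2
  proof -
    have "D1 * (C1 * Y) = D1 * C1 * Y" "D2 * (C2 * Z0) = D2 * C2 * Z0"
      by (rule mat_assoc[symmetric]; use DC Y Z0 in simp)+
    then show ?thesis
      unfolding split[OF DC] split[OF cand]
      using low_rank_fit_optimal[OF X Y assms(10,4) k(1) DC(1), of "C1 * Y"]
        low_rank_fit_optimal[OF X Z0 assms(11,5) k(2) DC(3), of "C2 * Z0"] DC Y Z0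
      by simp
  qed
  then show ?thesis
    using cand unfolding is_arg_min_def by (auto simp: not_less simp del: assoc_mult_mat)
qed

end
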